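(* Let $p$ be a prime and let $F\colon\mathbb{F}_{p^n}\to\mathbb{F}_{p^m}$ be a plateaued function whose preimage distribution is of type $(+)$ or of type $(-)$, where the unique preimage is $F^{-1}(0)$; that is, either type $(+)$: $|F^{-1}(0)|=p^{n-m}+p^{n/2}-p^{n/2-m}$ and $|F^{-1}(\beta)|=p^{n-m}-p^{n/2-m}$ for all $\beta\ne0$, or type $(-)$: $|F^{-1}(0)|=p^{n-m}-p^{n/2}+p^{n/2-m}$ and $|F^{-1}(\beta)|=p^{n-m}+p^{n/2-m}$ for all $\beta\neq0$. Then $F$ is bent. More precisely, $W_F(b,0)=-p^{n/2}$ for all $b\in\mathbb{F}_{p^m}^*$ if $F$ is of type $(-)$, and $W_F(b,0)=p^{n/2}$ for all $b\in\mathbb{F}_{p^m}^*$ if $F$ is of type $(+)$.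
   Context: Let $\zeta_p=e^{2\pi i/p}$ and let $\operatorname{Tr}$ denote the absolute trace (of $\mathbb{F}_{p^m}$ or $\mathbb{F}_{p^n}$ to $\mathbb{F}_p$). The Walsh transform of $F\colon\mathbb{F}_{p^n}\to\mathbb{F}_{p^m}$ is $W_F(b,a)=\sum_{x\in\mathbb{F}_{p^n}}\zeta_p^{\operatorname{Tr}(bF(x))-\operatorname{Tr}(ax)}$ for $b\in\mathbb{F}_{p^m}$, $a\in\mathbb{F}_{p^n}$. $F$ is plateaued if for every $b\in\mathbb{F}_{p^m}^*$ there is an integer $s_b$ with $0\le s_b\le n$ such that $|W_F(b,a)|\in\{0,p^{(n+s_b)/2}\}$ for all $a\in\mathbb{F}_{p^n}$. $F$ is bent if $|W_F(b,a)|=p^{n/2}$ for all $b\in\mathbb{F}_{p^m}^*$ and all $a\in\mathbb{F}_{p^n}$. *)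

theory Defs
  imports
    "HOL-Analysis.Analysis"
    "HOL-Computational_Algebra.Computational_Algebra"
    "HOL-Number_Theory.Number_Theory"
begin

(* The field with p ^ n elements is an arbitrary type 'a of class finite_field with
   CARD('a) = p ^ n.  The parameters p and n are passed explicitly. *)

definition abs_trace :: "nat \<Rightarrow> nat \<Rightarrow> 'a::finite_field \<Rightarrow> 'a" where
  "abs_trace p n x = (\<Sum>i<n. x ^ (p ^ i))"

(* The absolute trace lies in the prime subfield {of_nat k | k < p} of 'a; as an exponent of a
   p-th root of unity it is replaced by its representative in {0..<p}.  See the lemma
   ex1_prime_field_rep_abs_trace below for existence and uniqueness. *)
definition prime_field_rep :: "nat \<Rightarrow> 'a::finite_field \<Rightarrow> nat" where
  "prime_field_rep p y = (THE k. k < p \<and> of_nat k = y)"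

definition Tr :: "nat \<Rightarrow> nat \<Rightarrow> 'a::finite_field \<Rightarrow> int" where
  "Tr p n x = int (prime_field_rep p (abs_trace p n x))"

definition zeta :: "nat \<Rightarrow> complex" where
  "zeta p = exp (2 * of_real pi * \<i> / of_nat p)"

definition walsh ::
  "nat \<Rightarrow> nat \<Rightarrow> nat \<Rightarrow> ('a::finite_field \<Rightarrow> 'b::finite_field) \<Rightarrow> 'b \<Rightarrow> 'a \<Rightarrow> complex" where
  "walsh p n m F b a = (\<Sum>x\<in>UNIV. zeta p powi (Tr p m (b * F x) - Tr p n (a * x)))"

definition plateaued ::
  "nat \<Rightarrow> nat \<Rightarrow> nat \<Rightarrow> ('a::finite_field \<Rightarrow> 'b::finite_field) \<Rightarrow> bool" where
  "plateaued p n m F \<longleftrightarrow>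
     (\<forall>b. b \<noteq> 0 \<longrightarrow>
       (\<exists>s\<le>n. \<forall>a. norm (walsh p n m F b a) \<in> {0, real p powr (real (n + s) / 2)}))"

definition bent ::
  "nat \<Rightarrow> nat \<Rightarrow> nat \<Rightarrow> ('a::finite_field \<Rightarrow> 'b::finite_field) \<Rightarrow> bool" where
  "bent p n m F \<longleftrightarrow>
     (\<forall>b a. b \<noteq> 0 \<longrightarrow> norm (walsh p n m F b a) = real p powr (real n / 2))"

(* Real exponents throughout: neither m \<le> n nor the parity of n is presupposed. *)
definition type_plus ::
  "nat \<Rightarrow> nat \<Rightarrow> nat \<Rightarrow> ('a::finite_field \<Rightarrow> 'b::finite_field) \<Rightarrow> bool" where
  "type_plus p n m F \<longleftrightarrow>
     real (card (F -` {0})) =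
       real p powr (real n - real m) + real p powr (real n / 2) - real p powr (real n / 2 - real m) \<and>
     (\<forall>\<beta>. \<beta> \<noteq> 0 \<longrightarrow>
       real (card (F -` {\<beta>})) =
         real p powr (real n - real m) - real p powr (real n / 2 - real m))"

definition type_minus ::
  "nat \<Rightarrow> nat \<Rightarrow> nat \<Rightarrow> ('a::finite_field \<Rightarrow> 'b::finite_field) \<Rightarrow> bool" where
  "type_minus p n m F \<longleftrightarrow>
     real (card (F -` {0})) =
       real p powr (real n - real m) - real p powr (real n / 2) + real p powr (real n / 2 - real m) \<and>
     (\<forall>\<beta>. \<beta> \<noteq> 0 \<longrightarrow>
       real (card (F -` {\<beta>})) =
         real p powr (real n - real m) + real p powr (real n / 2 - real m))"

lemma CHAR_eq_of_CARD_eq: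
  assumes "prime p" "CARD('a::finite_field) = p ^ n"
  shows "CHAR('a) = p"
proof -
  have "CHAR('a) \<noteq> 1" by simp
  moreover have "CHAR('a) dvd p ^ n"
    using CHAR_dvd_CARD[where 'a='a] assms(2) by simp
  moreover have "CHAR('a) > 0"
    by (rule finite_imp_CHAR_pos) simp
  ultimately have "prime CHAR('a)"
    using prime_CHAR_semidom by blast
  then show ?thesis
    using \<open>CHAR('a) dvd p ^ n\<close> assms(1) prime_dvd_power primes_dvd_imp_eq by blast
qed

lemma abs_trace_power_p:
  assumes p: "prime p" and card: "CARD('a::finite_field) = p ^ n"
  shows "abs_trace p n x ^ p = abs_trace p n (x :: 'a)"
proof -
  have ch: "CHAR('a) = p" using CHAR_eq_of_CARD_eq[OF p card] .
  have "abs_trace p n x ^ p = (\<Sum>i<n. x ^ (p ^ Suc i))"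
    unfolding abs_trace_def
    by (subst freshmans_dream_sum) (use ch p in \<open>simp_all add: power_mult[symmetric] mult.commute\<close>)
  also have "\<dots> = (\<Sum>i<n. x ^ (p ^ i)) + x ^ (p ^ n) - x ^ (p ^ 0)"
    using sum.lessThan_Suc_shift[of "\<lambda>i. x ^ (p ^ i)" n] by (simp add: algebra_simps)
  also have "x ^ (p ^ n) = x"
    using finite_field_power_card_eq_same[of x] card by simp
  finally show ?thesis by (simp add: abs_trace_def)
qed

lemma ex1_prime_field_rep_abs_trace:
  assumes p: "prime p" and card: "CARD('a::finite_field) = p ^ n"
  shows "\<exists>!k. k < p \<and> of_nat k = abs_trace p n (x :: 'a)"
proof -
  have ch: "CHAR('a) = p" using CHAR_eq_of_CARD_eq[OF p card] .
  have p1: "p > 1" using p prime_gt_1_nat by blast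
  have inj: "inj_on (of_nat :: nat \<Rightarrow> 'a) {..<p}"
    by (intro inj_onI) (auto simp: of_nat_eq_iff_cong_CHAR ch cong_def)
  define q :: "'a poly" where "q = Polynomial.monom 1 p - Polynomial.monom 1 1"
  have "Polynomial.coeff q p = 1" using p1 by (simp add: q_def)
  then have q0: "q \<noteq> 0" by auto
  have deg: "Polynomial.degree q \<le> p"
    unfolding q_def using p1 by (intro degree_diff_le) (auto simp: degree_monom_eq)
  have roots: "{y. poly q y = 0} = {y. y ^ p = y}"
    by (simp add: q_def poly_monom)
  have "(of_nat k :: 'a) ^ p = of_nat k" for k
  proof (induction k)
    case (Suc k)
    have "(1 + of_nat k :: 'a) ^ p = 1 ^ p + of_nat k ^ p"
      by (rule freshmans_dream) (simp_all add: ch p)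
    then show ?case by (simp add: Suc.IH)
  qed (use p1 in simp)
  then have sub: "of_nat ` {..<p} \<subseteq> {y::'a. y ^ p = y}" by auto
  have "card {y::'a. y ^ p = y} \<le> p"
    using card_poly_roots_bound[OF q0] deg roots by simp
  then have "of_nat ` {..<p} = {y::'a. y ^ p = y}"
    using card_subset_eq[OF _ sub] card_mono[OF _ sub] card_image[OF inj] by simp
  then have "abs_trace p n x \<in> of_nat ` {..<p}"
    using abs_trace_power_p[OF p card] by simp
  then show ?thesis using inj by (auto simp: inj_on_def)
qed

end

theory Submission
  imports Defs
begin

text \<open>Grouping the sum \<open>W\<^sub>F(b,0)\<close> by the values of \<open>F\<close> and using that a nontrivial character sums to
  zero gives \<open>W\<^sub>F(b,0) = |F\<inverse>(0)| - |F\<inverse>(\<beta>)|\<close> for any \<open>\<beta> \<noteq> 0\<close>, which is \<open>\<plusminus>p\<^bsup>n/2\<^esup>\<close>. Since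
  this is nonzero, plateauedness forces \<open>s\<^sub>b = 0\<close>, so every \<open>|W\<^sub>F(b,a)|\<^sup>2\<close> is \<open>0\<close> or \<open>p\<^sup>n\<close>. By
  Parseval these \<open>p\<^sup>n\<close> numbers sum to \<open>p\<^bsup>2n\<^esup>\<close>, so none of them vanishes.\<close>

text \<open>The canonical additive character of the field. The exponent is the natural-number
  representative of the trace, so ordinary power laws apply instead of those for
  \<open>powi\<close>.\<close>

definition add_char :: "nat \<Rightarrow> nat \<Rightarrow> 'a::finite_field \<Rightarrow> complex" where
  "add_char p n x = zeta p ^ prime_field_rep p (abs_trace p n x)"

lemma zeta_power_eq_1_iff:
  assumes "p > 0"
  shows "zeta p ^ k = 1 \<longleftrightarrow> p dvd k"
proof -
  have "zeta p ^ k = exp (2 * of_real pi * \<i> * of_nat k / of_nat p)"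
    by (simp add: zeta_def exp_of_nat_mult[symmetric] field_simps)
  then show ?thesis
    using complex_root_unity_eq_1[of p k] assms by simp
qed

lemma zeta_power_mod:
  assumes "p > 0"
  shows "zeta p ^ (k mod p) = zeta p ^ k"
proof -
  have "zeta p ^ (p * (k div p) + k mod p) = (zeta p ^ p) ^ (k div p) * zeta p ^ (k mod p)"
    by (metis power_add power_mult)
  moreover have "zeta p ^ p = 1"
    by (rule zeta_power_eq_1_iff[OF assms, THEN iffD2]) (rule dvd_refl)
  ultimately show ?thesis by simp
qed

lemma norm_zeta [simp]: "norm (zeta p) = 1"
proof -
  have "zeta p = exp (\<i> * of_real (2 * pi / real p))" by (simp add: zeta_def mult_ac)
  then show ?thesis by (simp only: norm_exp_i_times)
qed

lemma norm_add_char [simp]: "norm (add_char p n x) = 1"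
  by (simp add: add_char_def norm_power)

lemma add_char_nonzero [simp]: "add_char p n x \<noteq> 0"
proof
  assume "add_char p n x = 0"
  then have "norm (add_char p n x) = 0" by (simp only: norm_zero)
  then show False by simp
qed

lemma add_char_mult_cnj [simp]: "add_char p n x * cnj (add_char p n x) = 1"
  by (simp add: complex_norm_square[symmetric])

text \<open>Character values have norm 1, so the negative exponent in \<open>walsh\<close> turns
  into a complex conjugate.\<close>

lemma walsh_eq_sum_add_char:
  "walsh p n m F b a = (\<Sum>x\<in>UNIV. add_char p m (b * F x) * cnj (add_char p n (a * x)))"
proof -
  have "zeta p \<noteq> 0" using norm_zeta[of p] by (metis norm_zero zero_neq_one)
  then have "zeta p powi (Tr p m y - Tr p n x) = add_char p m y / add_char p n x"
    for x :: 'a and y :: 'b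
    by (simp add: Tr_def add_char_def power_int_diff)
  moreover have "inverse (add_char p n x) = cnj (add_char p n x)" for x :: 'a
    by (rule inverse_unique) simp
  ultimately show ?thesis by (simp add: walsh_def divide_inverse)
qed

context
  fixes p n :: nat
  assumes p: "prime p" and card: "CARD('a::finite_field) = p ^ n"
begin

lemma abs_trace_add: "abs_trace p n (x + y :: 'a) = abs_trace p n x + abs_trace p n y"
proof -
  have "(x + y) ^ p ^ i = x ^ p ^ i + y ^ p ^ i" for i
    using freshmans_dream'[where 'a = 'a, OF _ refl] CHAR_eq_of_CARD_eq[OF p card] p by metis
  then show ?thesis by (simp add: abs_trace_def sum.distrib)
qed

lemma of_nat_prime_field_rep_abs_trace:
  "of_nat (prime_field_rep p (abs_trace p n x)) = abs_trace p n (x :: 'a)"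
  and prime_field_rep_abs_trace_less: "prime_field_rep p (abs_trace p n (x :: 'a)) < p"
  using theI'[OF ex1_prime_field_rep_abs_trace[OF p card, of x]]
  by (simp_all add: prime_field_rep_def)

lemma add_char_add: "add_char p n (x + y :: 'a) = add_char p n x * add_char p n y"
proof -
  let ?r = "\<lambda>x::'a. prime_field_rep p (abs_trace p n x)"
  \<comment> \<open>Representatives of the trace add only modulo \<open>p\<close>; this suffices
    because \<open>zeta p ^ p = 1\<close>.\<close>
  have "(of_nat (?r (x + y)) :: 'a) = of_nat (?r x + ?r y)"
    by (simp add: of_nat_prime_field_rep_abs_trace flip: abs_trace_add)
  then have "[?r (x + y) = ?r x + ?r y] (mod p)"
    by (simp only: of_nat_eq_iff_cong_CHAR CHAR_eq_of_CARD_eq[OF p card])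
  then show ?thesis
    using zeta_power_mod[OF prime_gt_0_nat[OF p]] unfolding add_char_def cong_def
    by (metis power_add)
qed

lemma add_char_0 [simp]: "add_char p n (0 :: 'a) = 1"
  using add_char_add[of 0 0] by simp

lemma add_char_diff: "add_char p n (x - y :: 'a) = add_char p n x * cnj (add_char p n y)"
proof -
  have "add_char p n x * cnj (add_char p n y)
      = add_char p n (x - y) * (add_char p n y * cnj (add_char p n y))"
    using add_char_add[of "x - y" y] by simp
  then show ?thesis by simp
qed

text \<open>The trace is a nonzero polynomial function of degree at most \<open>p ^ (n - 1)\<close>,
  so it has too few roots to vanish on all \<open>p ^ n\<close> elements.\<close>

lemma exists_abs_trace_nonzero: "\<exists>x::'a. abs_trace p n x \<noteq> 0"
proof (rule ccontr)
  assume "\<not> ?thesis"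
  then have all: "abs_trace p n x = 0" for x :: 'a by blast
  have p1: "p > 1" using p prime_gt_1_nat by blast
  have "CARD('a) > 1" using card_mono[of UNIV "{0, 1 :: 'a}"] by simp
  then have n: "n > 0" using card by (cases n) auto
  define q :: "'a poly" where "q = (\<Sum>i<n. Polynomial.monom 1 (p ^ i))"
  \<comment> \<open>The linear coefficient witnesses \<open>q \<noteq> 0\<close>: as
    \<open>p > 1\<close>, the exponent \<open>p ^ i\<close> equals 1 only for \<open>i = 0\<close>,
    and \<open>n > 0\<close> puts this index in range.\<close>
  have "Polynomial.coeff q (p ^ 0) = (\<Sum>i<n. if i = 0 then 1 else 0)"
    using p1 by (auto simp: q_def coeff_sum intro!: sum.cong)
  then have q0: "q \<noteq> 0" using n by auto
  have "Polynomial.degree q \<le> p ^ (n - 1)"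
    unfolding q_def using p1
    by (intro degree_sum_le) (auto simp: degree_monom_eq intro!: power_increasing)
  moreover have "{x. poly q x = 0} = UNIV"
    using all by (simp add: q_def poly_sum poly_monom abs_trace_def)
  ultimately have "p ^ n \<le> p ^ (n - 1)"
    using card_poly_roots_bound[OF q0] card by simp
  then show False using p1 n by simp
qed

lemma sum_add_char_mult:
  "(\<Sum>a\<in>UNIV. add_char p n (a * t)) = (if t = (0 :: 'a) then of_nat CARD('a) else 0)"
proof (cases "t = 0")
  case False
  obtain x :: 'a where x: "abs_trace p n x \<noteq> 0" using exists_abs_trace_nonzero by blast
  have "\<not> p dvd prime_field_rep p (abs_trace p n x)"
    using x of_nat_prime_field_rep_abs_trace[of x] prime_field_rep_abs_trace_less[of x]
    by (metis dvd_imp_le gr0I not_le of_nat_0)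
  then have x1: "add_char p n x \<noteq> 1"
    using zeta_power_eq_1_iff[OF prime_gt_0_nat[OF p]] by (simp add: add_char_def)
  let ?S = "\<Sum>a\<in>UNIV. add_char p n (a * t)"
  \<comment> \<open>Translating by \<open>x / t\<close> multiplies the sum by
    \<open>add_char p n x\<close>, which is not 1, so the sum must be 0.\<close>
  have "?S = (\<Sum>a\<in>UNIV. add_char p n ((a + x / t) * t))"
    by (rule sum.reindex_bij_witness[of _ "\<lambda>a. a + x / t" "\<lambda>a. a - x / t"]) auto
  also have "\<dots> = (\<Sum>a\<in>UNIV. add_char p n x * add_char p n (a * t))"
    using False by (simp add: distrib_right add_char_add mult.commute[of "add_char p n x"])
  also have "\<dots> = add_char p n x * ?S" by (simp only: sum_distrib_left)
  finally show ?thesis using x1 False by simp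
qed simp

end

text \<open>Parseval's identity: after expanding the square, orthogonality over \<open>a\<close>
  leaves only the diagonal \<open>y = x\<close>, where the summand has modulus-one factors.\<close>

lemma sum_norm_walsh_squared:
  fixes F :: "'a::finite_field \<Rightarrow> 'b::finite_field"
  assumes "prime p" "CARD('a) = p ^ n"
  shows "(\<Sum>a\<in>UNIV. (norm (walsh p n m F b a))\<^sup>2) = (real p ^ n)\<^sup>2"
proof -
  let ?f = "\<lambda>x. add_char p m (b * F x)" and ?e = "\<lambda>x::'a. add_char p n x"
  have "complex_of_real (\<Sum>a\<in>UNIV. (norm (walsh p n m F b a))\<^sup>2)
      = (\<Sum>a\<in>UNIV. walsh p n m F b a * cnj (walsh p n m F b a))"
    by (simp add: complex_norm_square[symmetric])
  also have "\<dots> = (\<Sum>a\<in>UNIV. \<Sum>x\<in>UNIV. \<Sum>y\<in>UNIV. ?f x * cnj (?f y) * ?e (a * (y - x)))"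
    unfolding walsh_eq_sum_add_char cnj_sum sum_product right_diff_distrib add_char_diff[OF assms]
    by (intro sum.cong refl) simp
  also have "\<dots> = (\<Sum>x\<in>UNIV. \<Sum>y\<in>UNIV. ?f x * cnj (?f y) * (\<Sum>a\<in>UNIV. ?e (a * (y - x))))"
    by (subst sum.swap, rule sum.cong[OF refl], subst sum.swap) (simp add: sum_distrib_left)
  also have "\<dots> = (\<Sum>x\<in>UNIV. \<Sum>y\<in>UNIV. if y = x then of_nat CARD('a) * (?f x * cnj (?f x)) else 0)"
    by (intro sum.cong refl) (simp add: sum_add_char_mult[OF assms])
  also have "\<dots> = of_real ((real p ^ n)\<^sup>2)"
    by (simp add: power2_eq_square assms(2))
  finally show ?thesis by (simp only: of_real_eq_iff)
qed

lemma walsh_0_of_preimage_card: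
  fixes F :: "'a::finite_field \<Rightarrow> 'b::finite_field"
  assumes p: "prime p" and a: "CARD('a) = p ^ n" and b: "CARD('b) = p ^ m"
    and F: "\<And>\<beta>. \<beta> \<noteq> 0 \<Longrightarrow> real (card (F -` {\<beta>})) = c" and "b \<noteq> 0"
  shows "walsh p n m F b 0 = of_real (real (card (F -` {0})) - c)"
proof -
  have "walsh p n m F b 0 = (\<Sum>x\<in>UNIV. add_char p m (b * F x))"
    by (simp add: walsh_eq_sum_add_char add_char_0[OF p a])
  also have "\<dots> = (\<Sum>\<beta>\<in>UNIV. \<Sum>x | F x = \<beta>. add_char p m (b * F x))"
    using sum.group[of UNIV UNIV F "\<lambda>x. add_char p m (b * F x)"] by simp
  also have "\<dots> = (\<Sum>\<beta>\<in>UNIV. of_real (card (F -` {\<beta>})) * add_char p m (\<beta> * b))"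
    by (simp add: vimage_def mult.commute)
  \<comment> \<open>Every fibre size is split as \<open>c\<close> plus an excess, which can be
    nonzero only at 0. The constant part carries a full character sum, which vanishes since
    \<open>b \<noteq> 0\<close>.\<close>
  also have "\<dots> = (\<Sum>\<beta>\<in>UNIV. (if \<beta> = 0 then of_real (card (F -` {0}) - c) else 0)
      + of_real c * add_char p m (\<beta> * b))"
    by (intro sum.cong refl) (auto simp: F add_char_0[OF p b] simp del: of_real_of_nat_eq)
  also have "\<dots> = of_real (card (F -` {0}) - c)"
    using sum_add_char_mult[OF p b, of b] \<open>b \<noteq> 0\<close>
    by (simp add: sum.distrib flip: sum_distrib_left)
  finally show ?thesis .
qed

lemma plateaued_imp_bent:
  fixes F :: "'a::finite_field \<Rightarrow> 'b::finite_field"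
  assumes p: "prime p" and card: "CARD('a) = p ^ n" and F: "plateaued p n m F"
    and W0: "\<And>b. b \<noteq> 0 \<Longrightarrow> norm (walsh p n m F b 0) = real p powr (real n / 2)"
  shows "bent p n m F"
  unfolding bent_def
proof (intro allI impI)
  fix b :: 'b and a :: 'a
  assume b: "b \<noteq> 0"
  let ?W = "\<lambda>a. norm (walsh p n m F b a)"
  have p1: "real p > 1" using prime_gt_1_nat[OF p] by simp
  obtain s where s: "\<And>a. ?W a \<in> {0, real p powr (real (n + s) / 2)}"
    using F b unfolding plateaued_def by blast
  \<comment> \<open>The value at 0 is nonzero, so it is the plateau height, which is common to all
    \<open>a\<close>.\<close>
  have "real p powr (real n / 2) = real p powr (real (n + s) / 2)"
    using s[of 0] W0[OF b] p1 by simp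
  then have W: "?W a \<in> {0, real p powr (real n / 2)}" for a using s by simp
  have sq: "(real p powr (real n / 2))\<^sup>2 = real p ^ n"
    using p1 by (simp add: powr_power powr_realpow)
  \<comment> \<open>Each deficit is nonnegative, being 0 or \<open>p ^ n\<close>; by Parseval they
    sum to 0, so each one is 0.\<close>
  have "(\<Sum>a\<in>UNIV. real p ^ n - (?W a)\<^sup>2) = 0"
    by (simp add: sum_subtractf sum_norm_walsh_squared[OF p card] card power2_eq_square[of "real p ^ n"])
  moreover have "real p ^ n - (?W a)\<^sup>2 \<ge> 0" for a using W[of a] sq by auto
  ultimately have "real p ^ n - (?W a)\<^sup>2 = 0"
    using sum_nonneg_eq_0_iff[of UNIV "\<lambda>a. real p ^ n - (?W a)\<^sup>2"] by simp
  then have "?W a \<noteq> 0" using p1 by auto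
  then show "?W a = real p powr (real n / 2)" using W[of a] by simp
qed

theorem theorem4p2:
  fixes p n m :: nat and F :: "'a::finite_field \<Rightarrow> 'b::finite_field"
  assumes "prime p"
    and "CARD('a) = p ^ n"
    and "CARD('b) = p ^ m"
    and "plateaued p n m F"
    and "type_plus p n m F \<or> type_minus p n m F"
  shows "bent p n m F \<and>
    (type_minus p n m F \<longrightarrow>
      (\<forall>b. b \<noteq> 0 \<longrightarrow> walsh p n m F b 0 = - of_real (real p powr (real n / 2)))) \<and>
    (type_plus p n m F \<longrightarrow>
      (\<forall>b. b \<noteq> 0 \<longrightarrow> walsh p n m F b 0 = of_real (real p powr (real n / 2))))"
proof -
  \<comment> \<open>With \<open>c\<close> the common size of the other fibres, all terms involving
    \<open>m\<close> cancel in the difference.\<close>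
  have minus: "walsh p n m F b 0 = - of_real (real p powr (real n / 2))"
    if "type_minus p n m F" "b \<noteq> 0" for b
    using walsh_0_of_preimage_card[OF assms(1-3), of F _ b] that
    unfolding type_minus_def by simp
  have plus: "walsh p n m F b 0 = of_real (real p powr (real n / 2))"
    if "type_plus p n m F" "b \<noteq> 0" for b
    using walsh_0_of_preimage_card[OF assms(1-3), of F _ b] that
    unfolding type_plus_def by simp
  have "norm (walsh p n m F b 0) = real p powr (real n / 2)" if "b \<noteq> 0" for b
    using assms(5) minus[of b] plus[of b] that by auto
  then show ?thesis
    using plateaued_imp_bent[OF assms(1,2,4)] minus plus by blast
qed

end
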